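(* Let $m\ge 1$ and let $g$ be a real function which is $m$ times continuously differentiable in a neighbourhood of its isolated fixed point $x^*=0$, with $g(0)=0$ and $g'(0)=1$. Define, near $0$, $$h_1(x)=\int_0^x g(t)\,dt,\qquad h_j(x)=\int_0^x h_{j-1}(t)\,dt\quad\text{for } 2\le j\le m .$$ Then, for each $j=1,\dots,m$, the iteration function $h_j$ is at least a $(j-1)$-accelerator of $g$.
   Context: An accelerator of an iteration function $g$ with fixed point $x^*$ is an iteration function $h$ with $h(x^* )=x^*$ and $h'(x^* )=0$. An accelerator $h$ is a $k$-accelerator if $h'(x^* )=h^{(2)}(x^* )=\dots=h^{(k)}(x^* )=0$ and $h^{(k+1)}(x^* )\neq 0$. "At least a $k$-accelerator" means that $h$ is an accelerator and $h^{(i)}(x^* )=0$ for all $1\le i\le k$ (with no condition on derivatives of higher order). *)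

theory Defs
  imports "HOL-Analysis.Analysis"
begin

(* The n-th derivative is (deriv ^^ n) f. Since deriv is total, its value is only meaningful
   together with a statement that the derivatives exist, which the next predicate supplies:
   f has an n-th derivative at x, so the lower-order ones exist on a neighbourhood of x. *)
primrec times_differentiable_at :: "nat \<Rightarrow> (real \<Rightarrow> real) \<Rightarrow> real \<Rightarrow> bool" where
  "times_differentiable_at 0 f x \<longleftrightarrow> True"
| "times_differentiable_at (Suc n) f x \<longleftrightarrow>
     (\<forall>\<^sub>F y in nhds x. times_differentiable_at n f y) \<and>
     (deriv ^^ n) f differentiable (at x)"

definition times_continuously_differentiable_near ::
    "nat \<Rightarrow> (real \<Rightarrow> real) \<Rightarrow> real \<Rightarrow> bool" where
  "times_continuously_differentiable_near m f x \<longleftrightarrow>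
     (\<exists>U. open U \<and> x \<in> U \<and> (\<forall>y\<in>U. times_differentiable_at m f y) \<and>
          continuous_on U ((deriv ^^ m) f))"

definition isolated_fixed_point :: "(real \<Rightarrow> real) \<Rightarrow> real \<Rightarrow> bool" where
  "isolated_fixed_point g p \<longleftrightarrow> g p = p \<and> (\<forall>\<^sub>F x in at p. g x \<noteq> x)"

definition accelerator :: "(real \<Rightarrow> real) \<Rightarrow> real \<Rightarrow> (real \<Rightarrow> real) \<Rightarrow> bool" where
  "accelerator g p h \<longleftrightarrow> g p = p \<and> h p = p \<and> (h has_real_derivative 0) (at p)"

definition at_least_k_accelerator ::
    "nat \<Rightarrow> (real \<Rightarrow> real) \<Rightarrow> real \<Rightarrow> (real \<Rightarrow> real) \<Rightarrow> bool" where
  "at_least_k_accelerator k g p h \<longleftrightarrow>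
     accelerator g p h \<and>
     (\<forall>i\<in>{1..k}. times_differentiable_at i h p \<and> (deriv ^^ i) h p = 0)"

end

theory Submission
  imports Defs
begin

text \<open>
  Writing \<open>h 0 = g\<close>, the fundamental theorem of calculus gives \<open>h (i + 1)' = h i\<close> near \<open>0\<close>, so the
  \<open>i\<close>-th derivative of \<open>h j\<close> is \<open>h (j - i)\<close> near \<open>0\<close>, and every \<open>h k\<close> vanishes at \<open>0\<close>: for
  \<open>k \<ge> 1\<close> because the integral is over a degenerate interval, for \<open>k = 0\<close> because \<open>g 0 = 0\<close>.
\<close>

text \<open>\<open>nhds x\<close> includes \<open>x\<close> itself, so unfolding lowers the order by
  one at the same point.\<close>

lemma times_differentiable_at_Suc_imp_differentiable:
  "times_differentiable_at (Suc n) f x \<Longrightarrow> f differentiable (at x)"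
proof (induction n)
  case (Suc n)
  then have "\<forall>\<^sub>F y in nhds x. times_differentiable_at (Suc n) f y"
    by simp
  then show ?case
    using Suc.IH eventually_nhds_x_imp_x by blast
qed simp

lemma eventually_isCont_if_times_continuously_differentiable_near:
  assumes "times_continuously_differentiable_near m f p" and "m \<ge> 1"
  shows "\<forall>\<^sub>F x in nhds p. isCont f x"
proof -
  obtain n where m: "m = Suc n"
    using assms(2) by (cases m) auto
  obtain U where "open U" "p \<in> U" and U: "\<forall>x\<in>U. times_differentiable_at m f x"
    using assms(1) unfolding times_continuously_differentiable_near_def by blast
  moreover have "isCont f x" if "x \<in> U" for x
    using U that unfolding m
    by (blast intro: differentiable_imp_continuous_within
        times_differentiable_at_Suc_imp_differentiable)
  ultimately show ?thesis
    unfolding eventually_nhds by blast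
qed

text \<open>The fundamental theorem of calculus for germs at \<open>p\<close>. Since the conclusion
  holds on a whole neighbourhood, it makes \<open>H\<close> continuous near \<open>p\<close> and the
  lemma can be reapplied to \<open>H\<close>.\<close>

lemma eventually_has_real_derivative_interval_integral:
  fixes f H :: "real \<Rightarrow> real"
  assumes cont: "\<forall>\<^sub>F x in nhds p. isCont f x"
    and H: "\<forall>\<^sub>F x in nhds p. H x = (LBINT t=p..x. f t)"
  shows "\<forall>\<^sub>F x in nhds p. (H has_real_derivative f x) (at x)"
proof -
  obtain d where "d > 0"
    and d: "\<And>x. dist x p < d \<Longrightarrow> isCont f x \<and> H x = (LBINT t=p..x. f t)"
    using eventually_conj[OF cont H] unfolding eventually_nhds_metric by auto
  \<comment> \<open>Halving \<open>d\<close> keeps the closed interval, on which the fundamental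
    theorem is applied, inside the open ball.\<close>
  define a b where "a = p - d / 2" and "b = p + d / 2"
  have near: "dist x p < d" if "x \<in> {a..b}" for x
    using that \<open>d > 0\<close> by (auto simp: a_def b_def dist_real_def abs_real_def)
  have cont_ab: "continuous_on {a..b} f"
    using near d by (auto intro!: continuous_at_imp_continuous_on)
  have "(H has_real_derivative f x) (at x)" if x: "x \<in> {a<..<b}" for x
  proof -
    have "((\<lambda>u. LBINT t=p..u. f t) has_vector_derivative f x) (at x within {a..b})"
      using cont_ab x \<open>d > 0\<close> by (intro interval_integral_FTC2) (auto simp: a_def b_def)
    moreover have "at x within {a..b} = at x"
      using x by (intro at_within_interior) (simp add: interior_atLeastAtMost_real)
    ultimately have "((\<lambda>u. LBINT t=p..u. f t) has_real_derivative f x) (at x)"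
      by (simp add: has_real_derivative_iff_has_vector_derivative)
    then show ?thesis
      using x near d
      by (elim has_field_derivative_transform_within_open[where S = "{a<..<b}"]) auto
  qed
  moreover have "p \<in> {a<..<b}"
    using \<open>d > 0\<close> by (simp add: a_def b_def)
  ultimately show ?thesis
    unfolding eventually_nhds by (intro exI[of _ "{a<..<b}"]) simp
qed

lemma eventually_iterated_deriv_chain:
  fixes F :: "nat \<Rightarrow> real \<Rightarrow> real"
  assumes "\<And>i. i < n \<Longrightarrow> \<forall>\<^sub>F x in nhds p. (F i has_real_derivative F (Suc i) x) (at x)"
  shows "\<forall>\<^sub>F x in nhds p. times_differentiable_at n (F 0) x \<and> (deriv ^^ n) (F 0) x = F n x"
  using assms
proof (induction n)
  case (Suc n)
  then have IH: "\<forall>\<^sub>F x in nhds p.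
      times_differentiable_at n (F 0) x \<and> (deriv ^^ n) (F 0) x = F n x"
    by simp
  have "\<forall>\<^sub>F x in nhds p. (F n has_real_derivative F (Suc n) x) (at x)"
    using Suc.prems by simp
  \<comment> \<open>Differentiating once more at \<open>x\<close> needs agreement with
    \<open>F n\<close> near \<open>x\<close>, not just at \<open>x\<close>.\<close>
  moreover have "\<forall>\<^sub>F x in nhds p. \<forall>\<^sub>F y in nhds x.
      times_differentiable_at n (F 0) y \<and> (deriv ^^ n) (F 0) y = F n y"
    using IH by (simp only: eventually_eventually)
  ultimately show ?case
  proof eventually_elim
    case (elim x)
    then have td: "\<forall>\<^sub>F y in nhds x. times_differentiable_at n (F 0) y"
      and eq: "\<forall>\<^sub>F y in nhds x. F n y = (deriv ^^ n) (F 0) y"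
      by (auto elim: eventually_mono)
    have "((deriv ^^ n) (F 0) has_real_derivative F (Suc n) x) (at x)"
      using elim(1) DERIV_cong_ev[OF refl eq refl] by simp
    then show ?case
      using td by (auto simp: DERIV_imp_deriv real_differentiable_def)
  qed
qed simp

theorem proposition1:
  fixes m :: nat and g :: "real \<Rightarrow> real" and h :: "nat \<Rightarrow> real \<Rightarrow> real"
  assumes "m \<ge> 1"
    and "times_continuously_differentiable_near m g 0"
    and "isolated_fixed_point g 0"
    and "(g has_real_derivative 1) (at 0)"
    and "\<forall>\<^sub>F x in nhds 0. h 1 x = (LBINT t=0..x. g t)"
    and "\<forall>j\<in>{2..m}. \<forall>\<^sub>F x in nhds 0. h j x = (LBINT t=0..x. h (j - 1) t)"
  shows "\<forall>j\<in>{1..m}. at_least_k_accelerator (j - 1) g 0 (h j)"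
proof
  fix j assume j: "j \<in> {1..m}"
  \<comment> \<open>The hypotheses leave \<open>h 0\<close> free; setting it to \<open>g\<close>
    merges both integral hypotheses into one recursion.\<close>
  define G where "G = h(0 := g)"
  have g0: "g 0 = 0"
    using assms(3) by (simp add: isolated_fixed_point_def)
  have int: "\<forall>\<^sub>F x in nhds 0. G (Suc i) x = (LBINT t=ereal 0..x. G i t)" if "i < m" for i
  proof (cases "i = 0")
    case True
    then show ?thesis
      using assms(5) by (simp add: G_def zero_ereal_def)
  next
    case False
    then show ?thesis
      using assms(6)[rule_format, of "Suc i"] that by (simp add: G_def zero_ereal_def)
  qed
  \<comment> \<open>Continuity climbs from \<open>g\<close>: an integral of a function continuous
    near 0 is differentiable there.\<close>
  have cont: "\<forall>\<^sub>F x in nhds 0. isCont (G i) x" if "i \<le> m" for i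
    using that
  proof (induction i)
    case 0
    show ?case
      using eventually_isCont_if_times_continuously_differentiable_near[OF assms(2,1)]
      by (simp add: G_def)
  next
    case (Suc i)
    then have "\<forall>\<^sub>F x in nhds 0. (G (Suc i) has_real_derivative G i x) (at x)"
      by (intro eventually_has_real_derivative_interval_integral int) auto
    then show ?case
      by (rule eventually_mono) (rule DERIV_isCont)
  qed
  have der: "\<forall>\<^sub>F x in nhds 0. (G (Suc i) has_real_derivative G i x) (at x)" if "i < m" for i
    using eventually_has_real_derivative_interval_integral[OF cont int] that by simp
  have G0: "G i 0 = 0" if "i \<le> m" for i
  proof (cases i)
    case 0
    then show ?thesis
      by (simp add: G_def g0)
  next
    case (Suc k)
    then show ?thesis
      using eventually_nhds_x_imp_x[OF int[of k]] that by simp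
  qed
  have Gj: "G j = h j"
    using j by (simp add: G_def)
  have "\<forall>\<^sub>F x in nhds 0. times_differentiable_at i (h j) x \<and> (deriv ^^ i) (h j) x = G (j - i) x"
    if "i \<le> j" for i
  proof -
    \<comment> \<open>Differentiation lowers the index of \<open>G\<close>, so the chain is read
      backwards from \<open>j\<close>; \<open>k < i \<le> j\<close> keeps the subtraction from
      truncating.\<close>
    have "\<forall>\<^sub>F x in nhds 0. (G (j - k) has_real_derivative G (j - Suc k) x) (at x)"
      if "k < i" for k
      using der[of "j - Suc k"] \<open>i \<le> j\<close> that j by (simp add: Suc_diff_Suc)
    then show ?thesis
      using eventually_iterated_deriv_chain[where F = "\<lambda>k. G (j - k)" and n = i and p = 0]
      by (simp add: Gj)
  qed
  then have "times_differentiable_at i (h j) 0 \<and> (deriv ^^ i) (h j) 0 = 0" if "i \<le> j" for i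
    using that j G0[of "j - i"] eventually_nhds_x_imp_x by fastforce
  \<comment> \<open>For \<open>j = 1\<close> the range \<open>{1..j - 1}\<close> is empty, so the
    zero first derivative demanded by \<open>accelerator\<close> is obtained separately; there it is
    \<open>g 0 = 0\<close>.\<close>
  moreover have "j - 1 < m"
    using j by auto
  then have "(h j has_real_derivative 0) (at 0)"
    using eventually_nhds_x_imp_x[OF der[of "j - 1"]] G0[of "j - 1"] j Gj by simp
  ultimately show "at_least_k_accelerator (j - 1) g 0 (h j)"
    using g0 G0[of j] Gj j by (auto simp: at_least_k_accelerator_def accelerator_def)
qed

end
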